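(* Let $L\ge 1$ and let $\overline{\beta}_c\in\mathfrak{t}_+=\{\overline{\beta}\in\mathbb{R}^L:\beta_l\ge 0\ \text{for all } l\}$ be the closest point to $0$ of the convex hull of some nonempty subset of the vertices of the hypercube $\mathbb{H}=\mu_T(\mathbb{P}(\mathcal{H}))=[-\tfrac12,\tfrac12]^L$, where $\mathcal{H}=(\mathbb{C}^2)^{\otimes L}$. Then the set $Z_{\beta_c}\cap\mu^{-1}(\overline{\beta}_c)\subset\mathbb{P}(\mathcal{H})$ is nonempty if and only if $\overline{\beta}_c$ is not equal, up to a permutation of its components, to the vector $(\tfrac12,\tfrac12,\dots,\tfrac12,0)$ (with $L-1$ entries equal to $\tfrac12$ and one entry equal to $0$).
   Context: $\mathcal{H}=(\mathbb{C}^2)^{\otimes L}$ is the $L$-qubit Hilbert space, with the orthonormal basis $|i_1\rangle\otimes\cdots\otimes|i_L\rangle$, $i_l\in\{0,1\}$, and $\mathbb{P}(\mathcal{H})$ is its complex projective space. For a nonzero state $\Psi$, $\rho_l(\Psi)$ denotes the $2\times 2$ reduced density matrix of the $l$-th qubit, i.e. the partial trace of $|\Psi\rangle\langle\Psi|/\langle\Psi|\Psi\rangle$ over all other qubits, written in the basis $|0\rangle,|1\rangle$. Map $\mu$: $\mu([\Psi])=(\rho_1(\Psi)-\tfrac12\mathbb{1},\dots,\rho_L(\Psi)-\tfrac12\mathbb{1})$ (up to the factor $i$ that turns Hermitian matrices into elements of the Lie algebra of $K=SU(2)^{\times L}$). A vector $\overline\beta\in\mathbb{R}^L$ is identified with the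 collection of diagonal matrices $\mathrm{diag}(-\beta_l,\beta_l)$, $l=1,\dots,L$ (i.e. with an element of the Lie algebra $\mathfrak{t}$ of the diagonal maximal torus $T\subset K$). Thus $\mu^{-1}(\overline\beta)$ is the set of $[\Psi]$ with $\rho_l(\Psi)-\tfrac12\mathbb{1}=\mathrm{diag}(-\beta_l,\beta_l)$ for every $l$. Map $\mu_T:\mathbb{P}(\mathcal{H})\to\mathbb{R}^L$: the $l$-th component of $\mu_T([\Psi])$ is $\langle 1|\rho_l(\Psi)|1\rangle-\tfrac12$ (the diagonal part of $\mu$). Set $Z_\beta$: for $\overline\beta\in\mathbb{R}^L$ let $T_\beta=\{k_t:t\in\mathbb{R}\}$, where $k_t=\bigotimes_{l=1}^L\mathrm{diag}(e^{-i\beta_l t},e^{i\beta_l t})$ acts on $\mathbb{P}(\mathcal{H})$. $Z_\beta$ is the union of those connected components of the set of $T_\beta$-fixed points in $\mathbb{P}(\mathcal{H})$ on which $\langle\mu_T(x),\overline\beta\rangle=\langle\overline\beta,\overline\beta\rangle$, where $\langle\cdot,\cdot\rangle$ is the Euclidean inner product on $\mathbb{R}^L$. *)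

theory Defs
  imports "HOL-Analysis.Analysis"
begin

section \<open>States of finitely many qubits\<close>

text \<open>
  The qubits are indexed by a finite type \<^typ>\<open>'n\<close>, so \<open>L = CARD('n)\<close>, which is at least 1.  A
  configuration \<open>i :: 'n \<Rightarrow> 2\<close> labels the basis vector that is the tensor product of the \<open>|i l\<rangle>\<close>,
  where the two elements of the type \<open>2\<close> are \<open>0\<close> and \<open>1\<close>.  The library norm on \<^typ>\<open>complex ^ 'm\<close> is
  the Hilbert space norm, so \<open>\<langle>\<Psi>|\<Psi>\<rangle> = (norm \<Psi>)\<^sup>2\<close>.
\<close>

type_synonym 'n qubits = "complex ^ ('n \<Rightarrow> 2)"
type_synonym 'n operator = "complex ^ ('n \<Rightarrow> 2) ^ ('n \<Rightarrow> 2)"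

definition pure_state :: "'n::finite qubits \<Rightarrow> 'n operator" where
  "pure_state \<Psi> = (\<chi> i j. \<Psi> $ i * cnj (\<Psi> $ j) / of_real ((norm \<Psi>)\<^sup>2))"

text \<open>
  Given \<open>a\<close>, the configurations \<open>i\<close> with \<open>i l = a\<close> run exactly once through the configurations of
  the qubits other than \<open>l\<close>, and \<open>i(l := b)\<close> agrees with \<open>i\<close> on those.
\<close>

definition partial_trace_others :: "'n::finite \<Rightarrow> 'n operator \<Rightarrow> complex ^ 2 ^ 2" where
  "partial_trace_others l D = (\<chi> a b. \<Sum>i | i l = a. D $ i $ (i(l := b)))"

definition reduced_density :: "'n::finite \<Rightarrow> 'n qubits \<Rightarrow> complex ^ 2 ^ 2" where
  "reduced_density l \<Psi> = partial_trace_others l (pure_state \<Psi>)"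

definition diag2 :: "complex \<Rightarrow> complex \<Rightarrow> complex ^ 2 ^ 2" where
  "diag2 a b = (\<chi> r c. if r \<noteq> c then 0 else if r = 0 then a else b)"

definition tensor_operator :: "('n::finite \<Rightarrow> complex ^ 2 ^ 2) \<Rightarrow> 'n operator" where
  "tensor_operator A = (\<chi> i j. \<Prod>l\<in>UNIV. A l $ i l $ j l)"

lemma pure_state_scale:
  assumes "c \<noteq> 0"
  shows "pure_state (c *s \<Psi>) = pure_state \<Psi>"
proof -
  have "norm (c *s \<Psi>) = cmod c * norm \<Psi>"
    by (simp add: norm_vec_def norm_mult L2_set_right_distrib)
  then have "of_real ((norm (c *s \<Psi>))\<^sup>2) = c * cnj c * of_real ((norm \<Psi>)\<^sup>2)"
    by (simp add: power_mult_distrib complex_norm_square flip: of_real_power)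
  with assms show ?thesis
    by (simp add: pure_state_def vec_eq_iff)
qed


section \<open>Projective space\<close>

text \<open>
  Points are complex lines through the origin; the topology is the quotient topology of the
  nonzero vectors.
\<close>

definition proj :: "complex ^ 'm::finite \<Rightarrow> (complex ^ 'm) set" where
  "proj \<Psi> = vec.span {\<Psi>}"

definition projective_space :: "(complex ^ 'm::finite) set set" where
  "projective_space = proj ` (- {0})"

definition projective_topology :: "(complex ^ 'm::finite) set topology" where
  "projective_topology =
     topology (\<lambda>U. U \<subseteq> projective_space \<and> open {\<Psi>. \<Psi> \<noteq> 0 \<and> proj \<Psi> \<in> U})"

definition representative :: "(complex ^ 'm::finite) set \<Rightarrow> complex ^ 'm" where
  "representative x = (SOME \<Psi>. \<Psi> \<noteq> 0 \<and> proj \<Psi> = x)"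

lemma openin_projective_topology:
  fixes U :: "(complex ^ 'm::finite) set set"
  shows "openin projective_topology U \<longleftrightarrow>
     U \<subseteq> projective_space \<and> open {\<Psi>. \<Psi> \<noteq> 0 \<and> proj \<Psi> \<in> U}"
proof -
  have "istopology (\<lambda>U :: (complex ^ 'm) set set. U \<subseteq> projective_space \<and> open {\<Psi>. \<Psi> \<noteq> 0 \<and> proj \<Psi> \<in> U})"
    unfolding istopology_def
  proof (intro conjI allI impI)
    fix S T :: "(complex ^ 'm) set set"
    assume S: "S \<subseteq> projective_space \<and> open {\<Psi>. \<Psi> \<noteq> 0 \<and> proj \<Psi> \<in> S}"
      and T: "T \<subseteq> projective_space \<and> open {\<Psi>. \<Psi> \<noteq> 0 \<and> proj \<Psi> \<in> T}"
    have eq: "{\<Psi>. \<Psi> \<noteq> 0 \<and> proj \<Psi> \<in> S \<inter> T} =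
        {\<Psi>. \<Psi> \<noteq> 0 \<and> proj \<Psi> \<in> S} \<inter> {\<Psi>. \<Psi> \<noteq> 0 \<and> proj \<Psi> \<in> T}"
      by auto
    show "S \<inter> T \<subseteq> projective_space" using S by blast
    show "open {\<Psi>. \<Psi> \<noteq> 0 \<and> proj \<Psi> \<in> S \<inter> T}"
      unfolding eq using S T by (simp add: open_Int)
  next
    fix K :: "(complex ^ 'm) set set set"
    assume K: "\<forall>S\<in>K. S \<subseteq> projective_space \<and> open {\<Psi>. \<Psi> \<noteq> 0 \<and> proj \<Psi> \<in> S}"
    have eq: "{\<Psi>. \<Psi> \<noteq> 0 \<and> proj \<Psi> \<in> \<Union>K} = (\<Union>S\<in>K. {\<Psi>. \<Psi> \<noteq> 0 \<and> proj \<Psi> \<in> S})"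
      by auto
    show "\<Union>K \<subseteq> projective_space" using K by blast
    show "open {\<Psi>. \<Psi> \<noteq> 0 \<and> proj \<Psi> \<in> \<Union>K}"
      unfolding eq using K by blast
  qed
  then show ?thesis
    by (simp add: projective_topology_def)
qed

lemma topspace_projective_topology:
  "topspace projective_topology = (projective_space :: (complex ^ 'm::finite) set set)"
proof -
  have "{\<Psi>::complex ^ 'm. \<Psi> \<noteq> 0 \<and> proj \<Psi> \<in> projective_space} = - {0}"
    by (auto simp: projective_space_def)
  then have "openin projective_topology (projective_space :: (complex ^ 'm) set set)"
    by (simp add: openin_projective_topology open_Compl)
  then show ?thesis
    by (meson openin_projective_topology openin_subset openin_topspace subset_antisym)
qed

lemma quotient_map_proj: "quotient_map (top_of_set (- {0})) projective_topology proj"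
proof -
  have "openin (top_of_set (- {0})) {\<Psi> \<in> - {0}. proj \<Psi> \<in> U} \<longleftrightarrow> openin projective_topology U"
    if "U \<subseteq> projective_space" for U :: "(complex ^ 'a) set set"
  proof -
    have "{\<Psi> \<in> - {0}. proj \<Psi> \<in> U} = {\<Psi>. \<Psi> \<noteq> 0 \<and> proj \<Psi> \<in> U}"
      by auto
    moreover have "openin (top_of_set (- {0})) S \<longleftrightarrow> S \<subseteq> - {0} \<and> open S" for S :: "(complex ^ 'a) set"
      by (metis openin_open_eq open_Compl closed_singleton)
    ultimately show ?thesis
      using that by (auto simp only: openin_projective_topology)
  qed
  then show ?thesis
    by (simp add: quotient_map_def topspace_projective_topology projective_space_def)
qed

lemma representative_proj:
  assumes "\<Psi> \<noteq> 0"
  obtains c where "c \<noteq> 0" "representative (proj \<Psi>) = c *s \<Psi>"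
proof -
  have "representative (proj \<Psi>) \<noteq> 0 \<and> proj (representative (proj \<Psi>)) = proj \<Psi>"
    unfolding representative_def by (rule someI[of _ \<Psi>]) (use assms in simp)
  moreover have "representative (proj \<Psi>) \<in> proj (representative (proj \<Psi>))"
    by (simp add: proj_def vec.span_base)
  ultimately obtain c where "representative (proj \<Psi>) = c *s \<Psi>"
    by (auto simp: proj_def vec.span_singleton)
  with \<open>representative (proj \<Psi>) \<noteq> 0 \<and> _\<close> that show thesis
    by (cases "c = 0") auto
qed


section \<open>The momentum maps\<close>

text \<open>
  Hermitian matrices are used in place of elements of the Lie algebra; the factor \<open>\<i>\<close> is omitted.
\<close>

definition mu :: "'n::finite qubits set \<Rightarrow> (complex ^ 2 ^ 2) ^ 'n" where
  "mu x = (\<chi> l. reduced_density l (representative x) - mat (1 / 2))"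

definition mu_T :: "'n::finite qubits set \<Rightarrow> real ^ 'n" where
  "mu_T x = (\<chi> l. Re (reduced_density l (representative x) $ 1 $ 1) - 1 / 2)"

definition diagonal_element :: "real ^ 'n::finite \<Rightarrow> (complex ^ 2 ^ 2) ^ 'n" where
  "diagonal_element \<beta> = (\<chi> l. diag2 (- of_real (\<beta> $ l)) (of_real (\<beta> $ l)))"

definition mu_fibre :: "real ^ 'n::finite \<Rightarrow> 'n qubits set set" where
  "mu_fibre \<beta> = {x \<in> projective_space. mu x = diagonal_element \<beta>}"

lemma reduced_density_representative:
  assumes "\<Psi> \<noteq> 0"
  shows "reduced_density l (representative (proj \<Psi>)) = reduced_density l \<Psi>"
  using representative_proj[OF assms] by (metis pure_state_scale reduced_density_def)

lemma mu_proj: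
  "\<Psi> \<noteq> 0 \<Longrightarrow> mu (proj \<Psi>) = (\<chi> l. reduced_density l \<Psi> - mat (1 / 2))"
  by (simp add: mu_def reduced_density_representative)

lemma mu_T_proj:
  "\<Psi> \<noteq> 0 \<Longrightarrow> mu_T (proj \<Psi>) = (\<chi> l. Re (reduced_density l \<Psi> $ 1 $ 1) - 1 / 2)"
  by (simp add: mu_T_def reduced_density_representative)


section \<open>The hypercube\<close>

definition hypercube :: "(real ^ 'n::finite) set" where
  "hypercube = cbox (\<chi> l. - 1 / 2) (\<chi> l. 1 / 2)"

definition hypercube_vertices :: "(real ^ 'n::finite) set" where
  "hypercube_vertices = {v. v extreme_point_of hypercube}"

lemma hypercube_vertices_eq:
  "hypercube_vertices = {v :: real ^ 'n::finite. \<forall>l. v $ l = 1 / 2 \<or> v $ l = - 1 / 2}"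
proof (intro set_eqI iffI)
  fix v :: "real ^ 'n"
  assume "v \<in> hypercube_vertices"
  then have v: "v \<in> hypercube"
    and extr: "\<And>a b. a \<in> hypercube \<Longrightarrow> b \<in> hypercube \<Longrightarrow> v \<notin> open_segment a b"
    by (auto simp: hypercube_vertices_def extreme_point_of_def)
  have "v $ l = 1 / 2 \<or> v $ l = - 1 / 2" for l
  proof (rule ccontr)
    assume "\<not> ?thesis"
    moreover have "- 1 / 2 \<le> v $ l" "v $ l \<le> 1 / 2"
      using v by (auto simp: hypercube_def mem_box_cart)
    ultimately have lt: "- 1 / 2 < v $ l" "v $ l < 1 / 2" by auto
    define d where "d = min (1 / 2 - v $ l) (1 / 2 + v $ l)"
    have d: "0 < d" "d \<le> 1 / 2 - v $ l" "d \<le> 1 / 2 + v $ l" using lt by (auto simp: d_def)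
    define a where "a = v - axis l d"
    define b where "b = v + axis l d"
    have "a \<in> hypercube" "b \<in> hypercube"
      using v d by (auto simp: a_def b_def hypercube_def mem_box_cart axis_def)
    moreover have "a \<noteq> b"
    proof
      assume "a = b"
      then have "a $ l = b $ l" by simp
      with d show False by (simp add: a_def b_def axis_def)
    qed
    moreover have "v = midpoint a b"
      by (simp add: a_def b_def midpoint_def vec_eq_iff)
    ultimately show False
      using extr midpoint_in_open_segment by metis
  qed
  then show "v \<in> {v. \<forall>l. v $ l = 1 / 2 \<or> v $ l = - 1 / 2}" by simp
next
  fix v :: "real ^ 'n"
  assume "v \<in> {v. \<forall>l. v $ l = 1 / 2 \<or> v $ l = - 1 / 2}"
  then have v: "\<And>l. v $ l = 1 / 2 \<or> v $ l = - 1 / 2" by simp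
  have "v \<in> hypercube"
    unfolding hypercube_def mem_box_cart
  proof
    fix l show "(\<chi> l. - 1 / 2) $ l \<le> v $ l \<and> v $ l \<le> (\<chi> l. 1 / 2) $ l"
      using v[of l] by auto
  qed
  moreover have "v \<notin> open_segment a b" if "a \<in> hypercube" "b \<in> hypercube" for a b
  proof
    assume "v \<in> open_segment a b"
    then obtain u where u: "0 < u" "u < 1" "v = (1 - u) *\<^sub>R a + u *\<^sub>R b" and "a \<noteq> b"
      by (auto simp: in_segment)
    have "a $ l = b $ l" for l
    proof -
      have ab: "- 1 / 2 \<le> a $ l" "a $ l \<le> 1 / 2" "- 1 / 2 \<le> b $ l" "b $ l \<le> 1 / 2"
        using that by (auto simp: hypercube_def mem_box_cart)
      have eq: "v $ l = (1 - u) * a $ l + u * b $ l" using u(3) by simp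
      have nonneg: "(1 - u) * (1 / 2 - a $ l) \<ge> 0" "u * (1 / 2 - b $ l) \<ge> 0"
        "(1 - u) * (1 / 2 + a $ l) \<ge> 0" "u * (1 / 2 + b $ l) \<ge> 0"
        using u ab by auto
      have sums: "(1 - u) * (1 / 2 - a $ l) + u * (1 / 2 - b $ l) = 1 / 2 - v $ l"
        "(1 - u) * (1 / 2 + a $ l) + u * (1 / 2 + b $ l) = 1 / 2 + v $ l"
        unfolding eq by (simp_all add: field_simps)
      from v[of l] have
        "(1 - u) * (1 / 2 - a $ l) = 0 \<and> u * (1 / 2 - b $ l) = 0 \<or>
         (1 - u) * (1 / 2 + a $ l) = 0 \<and> u * (1 / 2 + b $ l) = 0"
      proof
        assume "v $ l = 1 / 2"
        then show ?thesis
          using nonneg(1,2) sums(1) add_nonneg_eq_0_iff[OF nonneg(1,2)] by simp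
      next
        assume "v $ l = - 1 / 2"
        then show ?thesis
          using nonneg(3,4) sums(2) add_nonneg_eq_0_iff[OF nonneg(3,4)] by simp
      qed
      then show ?thesis using u by auto
    qed
    then have "a = b" by (simp add: vec_eq_iff)
    with \<open>a \<noteq> b\<close> show False ..
  qed
  ultimately show "v \<in> hypercube_vertices"
    by (auto simp: hypercube_vertices_def extreme_point_of_def)
qed

lemma reduced_density_11:
  "reduced_density l \<Psi> $ 1 $ 1 =
     of_real ((\<Sum>i | i l = 1. (cmod (\<Psi> $ i))\<^sup>2) / (\<Sum>i\<in>UNIV. (cmod (\<Psi> $ i))\<^sup>2))"
proof -
  have "reduced_density l \<Psi> $ 1 $ 1 =
      (\<Sum>i | i l = 1. of_real ((cmod (\<Psi> $ i))\<^sup>2) / of_real ((norm \<Psi>)\<^sup>2))"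
    by (auto simp: reduced_density_def partial_trace_others_def pure_state_def
        complex_norm_square fun_upd_idem simp flip: of_real_power intro!: sum.cong)
  also have "\<dots> = of_real ((\<Sum>i | i l = 1. (cmod (\<Psi> $ i))\<^sup>2) / (norm \<Psi>)\<^sup>2)"
    by (simp add: sum_divide_distrib)
  finally show ?thesis
    by (simp add: norm_vec_def L2_set_def sum_nonneg)
qed

lemma sum_configurations_prod:
  fixes f :: "'n::finite \<Rightarrow> 2 \<Rightarrow> real"
  shows "(\<Sum>i\<in>UNIV. \<Prod>k\<in>UNIV. f k (i k)) = (\<Prod>k\<in>UNIV. f k 0 + f k 1)"
proof -
  have U: "(UNIV :: 2 set) = {0, 1}" using UNIV_2 by auto
  have "(\<Prod>k\<in>UNIV. \<Sum>b\<in>UNIV. f k b) = (\<Sum>i\<in>PiE UNIV (\<lambda>_. UNIV). \<Prod>k\<in>UNIV. f k (i k))"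
    by (rule prod_sum_PiE) auto
  moreover have "PiE UNIV (\<lambda>_. UNIV) = (UNIV :: ('n \<Rightarrow> 2) set)"
    by auto
  ultimately show ?thesis
    by (simp add: U)
qed

lemma mu_T_image: "mu_T ` projective_space = (hypercube :: (real ^ 'n::finite) set)"
proof (intro set_eqI iffI)
  fix v :: "real ^ 'n"
  assume "v \<in> mu_T ` projective_space"
  then obtain \<Psi> :: "'n qubits" where \<Psi>: "\<Psi> \<noteq> 0" "v = mu_T (proj \<Psi>)"
    by (auto simp: projective_space_def)
  have "0 \<le> v $ l + 1 / 2 \<and> v $ l + 1 / 2 \<le> 1" for l
  proof -
    have le: "(\<Sum>i | i l = 1. (cmod (\<Psi> $ i))\<^sup>2) \<le> (\<Sum>i\<in>UNIV. (cmod (\<Psi> $ i))\<^sup>2)"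
      by (rule sum_mono2) auto
    have "v $ l + 1 / 2 = (\<Sum>i | i l = 1. (cmod (\<Psi> $ i))\<^sup>2) / (\<Sum>i\<in>UNIV. (cmod (\<Psi> $ i))\<^sup>2)"
      using \<Psi> by (simp add: mu_T_proj reduced_density_11)
    with le show ?thesis
      by (simp add: sum_nonneg divide_le_eq_1 order_less_le)
  qed
  then have "- 1 / 2 \<le> v $ l \<and> v $ l \<le> 1 / 2" for l
    by (smt (verit) field_sum_of_halves)
  then show "v \<in> hypercube"
    by (auto simp: hypercube_def mem_box_cart)
next
  fix v :: "real ^ 'n"
  assume "v \<in> hypercube"
  then have v: "\<And>l. - 1 / 2 \<le> v $ l" "\<And>l. v $ l \<le> 1 / 2"
    by (auto simp: hypercube_def mem_box_cart)
  define f :: "'n \<Rightarrow> 2 \<Rightarrow> real" where "f k b = (if b = 1 then 1 / 2 + v $ k else 1 / 2 - v $ k)" for k b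
  have f: "f k b \<ge> 0" for k b
    using v[of k] by (auto simp: f_def)
  define \<Psi> :: "'n qubits" where "\<Psi> = (\<chi> i. of_real (\<Prod>k\<in>UNIV. sqrt (f k (i k))))"
  have sq: "(cmod (\<Psi> $ i))\<^sup>2 = (\<Prod>k\<in>UNIV. f k (i k))" for i
    by (simp only: \<Psi>_def vec_lambda_beta norm_of_real power2_abs prod_power_distrib
        real_sqrt_pow2[OF f])
  have one: "(\<Sum>i\<in>UNIV. (cmod (\<Psi> $ i))\<^sup>2) = 1"
    unfolding sq sum_configurations_prod by (simp add: f_def)
  have "\<Psi> \<noteq> 0" using one by auto
  moreover have "mu_T (proj \<Psi>) = v"
  proof -
    have "(\<Sum>i | i l = 1. (cmod (\<Psi> $ i))\<^sup>2) = 1 / 2 + v $ l" for l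
    proof -
      define g where "g k b = (if k = l \<and> b = 0 then 0 else f k b)" for k b
      have two: "b = 0 \<or> b = 1" for b :: 2 using exhaust_2[of b] by auto
      have "(\<Sum>i | i l = 1. (cmod (\<Psi> $ i))\<^sup>2) =
          (\<Sum>i\<in>UNIV. if i l = 1 then \<Prod>k\<in>UNIV. f k (i k) else 0)"
        unfolding sq by (simp add: sum.If_cases)
      also have "\<dots> = (\<Sum>i\<in>UNIV. \<Prod>k\<in>UNIV. g k (i k))"
      proof (rule sum.cong[OF refl])
        fix i :: "'n \<Rightarrow> 2"
        show "(if i l = 1 then \<Prod>k\<in>UNIV. f k (i k) else 0) = (\<Prod>k\<in>UNIV. g k (i k))"
        proof (cases "i l = 1")
          case True
          then show ?thesis by (auto simp: g_def intro!: prod.cong)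
        next
          case False
          then have "g l (i l) = 0" using two[of "i l"] by (auto simp: g_def)
          then have "(\<Prod>k\<in>UNIV. g k (i k)) = 0" by (meson UNIV_I finite prod_zero)
          with False show ?thesis by simp
        qed
      qed
      also have "\<dots> = (\<Prod>k\<in>UNIV. if k = l then 1 / 2 + v $ l else 1)"
        unfolding sum_configurations_prod by (rule prod.cong) (simp_all add: g_def f_def)
      finally show ?thesis by simp
    qed
    with \<open>\<Psi> \<noteq> 0\<close> one show ?thesis
      by (simp add: mu_T_proj reduced_density_11 vec_eq_iff)
  qed
  ultimately show "v \<in> mu_T ` projective_space"
    by (force simp: projective_space_def)
qed


section \<open>Fixed points of one-parameter subgroups\<close>

definition T_subgroup :: "real ^ 'n::finite \<Rightarrow> 'n operator set" where
  "T_subgroup \<beta> =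
     range (\<lambda>t::real. tensor_operator (\<lambda>l. diag2 (exp (- \<i> * of_real (\<beta> $ l * t)))
                                                 (exp (\<i> * of_real (\<beta> $ l * t)))))"

definition T_fixed_points :: "real ^ 'n::finite \<Rightarrow> 'n qubits set set" where
  "T_fixed_points \<beta> = {x \<in> projective_space. \<forall>k\<in>T_subgroup \<beta>. (*v) k ` x = x}"

definition Z_set :: "real ^ 'n::finite \<Rightarrow> 'n qubits set set" where
  "Z_set \<beta> =
     \<Union> {C \<in> connected_components_of (subtopology projective_topology (T_fixed_points \<beta>)).
           \<forall>x\<in>C. mu_T x \<bullet> \<beta> = \<beta> \<bullet> \<beta>}"

end

theory Submission
  imports Defs
begin

text \<open>
  Write \<open>W\<^sub>i\<close> for the hypercube vertex of a configuration \<open>i\<close>.  A state \<open>\<Psi>\<close> supported on configurations with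
  \<open>W\<^sub>i \<bullet> \<beta> = \<beta> \<bullet> \<beta>\<close> and with \<open>\<Sum>\<^sub>i |\<Psi>\<^sub>i|\<^sup>2 W\<^sub>i = \<beta>\<close> lies in \<open>Z\<^sub>\<beta>\<close>, and its \<open>l\<close>-th reduced density matrix is
  automatically diagonal when \<open>\<beta>\<^sub>l \<noteq> 0\<close>, because flipping qubit \<open>l\<close> leaves the support.  As \<open>\<beta>\<close> is a closest
  point, it is a convex combination of such vertices with weights \<open>q\<close>, and these weights can be put on
  configurations that vanish on the set \<open>Z\<close> of zeros of \<open>\<beta>\<close>.  If \<open>Z\<close> is empty, \<open>\<Psi>\<^sub>i = \<surd>q\<^sub>i\<close> works.
  Otherwise superpose each configuration with the one where all qubits of \<open>Z\<close> are set to 1, as in a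
  GHZ state, with a relative phase \<open>\<theta>\<^sub>i\<close>.  Off-diagonal terms survive only if \<open>Z\<close> is a single qubit, and they
  cancel if \<open>\<Sum>\<^sub>i q\<^sub>i cis \<theta>\<^sub>i = 0\<close>.  Such phases exist (close a polygon with sides \<open>q\<^sub>i\<close>) once every \<open>q\<^sub>i\<close> is at
  most \<open>1/2\<close>.  This holds because the vertices involved, restricted to the remaining qubits, are all at the
  same distance from their barycentre \<open>\<beta>\<close>; that distance is positive unless \<open>\<beta> = (1/2, \<dots>, 1/2, 0)\<close> up to order.
  In that case the remaining qubit would be in a pure state, so its reduced density matrix is not maximally mixed.
\<close>

lemma two_cases: "b = 0 \<or> b = (1 :: 2)"
  using exhaust_2[of b] by auto

section \<open>Closing a polygon with given side lengths\<close>

text \<open>As the second side turns, the length of the sum passes continuously from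
  \<open>cmod w + p\<close> (parallel) to \<open>\<bar>cmod w - p\<bar>\<close> (opposite). The
  hypotheses are the triangle inequalities for \<open>p\<close>, \<open>r\<close> and
  \<open>cmod w\<close>, which place \<open>r\<close> between these extremes.\<close>

lemma norm_add_cis_attains:
  fixes w :: complex and p r :: real
  assumes "0 \<le> p" "\<bar>r - p\<bar> \<le> cmod w" "cmod w \<le> r + p"
  obtains \<phi> where "cmod (w + of_real p * cis \<phi>) = r"
proof -
  \<comment> \<open>Measuring the angle from \<open>Arg w\<close> makes the two sides parallel at
    \<open>0\<close> and opposite at \<open>pi\<close>.\<close>
  define f where "f \<tau> = cmod (w + of_real p * cis (Arg w + \<tau>))" for \<tau>
  have f_eq: "f \<tau> = cmod (of_real (cmod w) + of_real p * cis \<tau>)" for \<tau>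
  proof -
    have "w + of_real p * cis (Arg w + \<tau>) = cis (Arg w) * (of_real (cmod w) + of_real p * cis \<tau>)"
      using rcis_cmod_Arg[of w] by (simp add: rcis_def cis_mult[symmetric] algebra_simps)
    then show ?thesis by (simp add: f_def norm_mult)
  qed
  have "f 0 = cmod w + p"
    using assms(1) by (simp add: f_eq flip: of_real_add)
  moreover have "f pi = \<bar>cmod w - p\<bar>"
    by (simp add: f_eq flip: of_real_diff)
  moreover have "continuous_on {0..pi} f"
    unfolding f_def by (intro continuous_intros)
  ultimately obtain \<tau> where "f \<tau> = r"
    using IVT2'[of f pi r 0] assms pi_ge_zero by (smt (verit, best))
  then show thesis
    using that by (auto simp: f_def)
qed

text \<open>A general target length \<open>r\<close> is what lets the induction remove one side at a
  time. The bounds on \<open>r\<close> say that in the polygon with sides \<open>p i\<close> and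
  \<open>r\<close> no side exceeds the sum of the others.\<close>

lemma polygon_attains:
  fixes p :: "'a \<Rightarrow> real"
  assumes "finite A" "\<And>i. i \<in> A \<Longrightarrow> 0 \<le> p i"
    and "0 \<le> r" "r \<le> sum p A" "\<And>i. i \<in> A \<Longrightarrow> 2 * p i - sum p A \<le> r"
  shows "\<exists>\<theta>. cmod (\<Sum>i\<in>A. of_real (p i) * cis (\<theta> i)) = r"
  using assms
proof (induction A arbitrary: r rule: finite_induct)
  case empty
  then show ?case by simp
next
  case (insert x A)
  \<comment> \<open>The sides in \<open>A\<close> are to reach a length \<open>s\<close> that forms
    a triangle with \<open>r\<close> and \<open>p x\<close>. Both this and the induction hypothesis
    bound \<open>s\<close> from below by the elements of \<open>?S\<close>; the largest of these is
    taken, and each of them is then checked against the upper bounds \<open>sum p A\<close> and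
    \<open>r + p x\<close>.\<close>
  let ?S = "insert \<bar>r - p x\<bar> ((\<lambda>i. 2 * p i - sum p A) ` A)"
  have fin: "finite ?S" using insert by simp
  define s where "s = Max ?S"
  have lower: "\<bar>r - p x\<bar> \<le> s" "\<And>i. i \<in> A \<Longrightarrow> 2 * p i - sum p A \<le> s"
    unfolding s_def using fin by (auto intro!: Max_ge)
  have "2 * p i - sum p A \<le> sum p A" if "i \<in> A" for i
    using member_le_sum[of i A p] insert that by auto
  moreover have "\<bar>r - p x\<bar> \<le> sum p A"
    using insert.prems(3) insert.prems(4)[of x] insert.hyps by auto
  ultimately have "s \<le> sum p A"
    unfolding s_def using fin by auto
  then obtain \<theta> where \<theta>: "cmod (\<Sum>i\<in>A. of_real (p i) * cis (\<theta> i)) = s"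
    using insert.IH[of s] insert.prems(1) lower by fastforce
  have "2 * p i - sum p A \<le> r + p x" if "i \<in> A" for i
    using insert.prems(4)[of i] insert.hyps that by auto
  moreover have "\<bar>r - p x\<bar> \<le> r + p x"
    using insert.prems(1)[of x] insert.prems(2) by auto
  ultimately have "s \<le> r + p x"
    unfolding s_def using fin by auto
  then obtain \<phi> where \<phi>:
    "cmod ((\<Sum>i\<in>A. of_real (p i) * cis (\<theta> i)) + of_real (p x) * cis \<phi>) = r"
    using norm_add_cis_attains[of "p x" r "\<Sum>i\<in>A. of_real (p i) * cis (\<theta> i)"] lower(1) \<theta>
      insert.prems(1)[of x] by auto
  have "(\<Sum>i\<in>A. of_real (p i) * cis ((\<theta>(x := \<phi>)) i)) = (\<Sum>i\<in>A. of_real (p i) * cis (\<theta> i))"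
    using insert.hyps by (intro sum.cong) auto
  then have "cmod (\<Sum>i\<in>insert x A. of_real (p i) * cis ((\<theta>(x := \<phi>)) i)) = r"
    using \<phi> insert.hyps by (simp add: add.commute)
  then show ?case by blast
qed

corollary polygon_closes:
  fixes p :: "'a \<Rightarrow> real"
  assumes "finite A" "\<And>i. i \<in> A \<Longrightarrow> 0 \<le> p i" "\<And>i. i \<in> A \<Longrightarrow> 2 * p i \<le> sum p A"
  obtains \<theta> where "(\<Sum>i\<in>A. of_real (p i) * cis (\<theta> i)) = 0"
  using polygon_attains[of A p 0] assms by (auto simp: sum_nonneg)

section \<open>Momentum maps in terms of amplitudes\<close>

text \<open>This is the value of \<open>mu_T\<close> at the basis state labelled
  \<open>i\<close>.\<close>

definition config_vertex :: "('n::finite \<Rightarrow> 2) \<Rightarrow> real ^ 'n" where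
  "config_vertex i = (\<chi> l. if i l = 1 then 1 / 2 else - 1 / 2)"

lemma norm_squared_vec: "(norm \<Psi>)\<^sup>2 = (\<Sum>i\<in>UNIV. (cmod (\<Psi> $ i))\<^sup>2)"
  for \<Psi> :: "complex ^ 'm::finite"
  by (simp add: norm_vec_def L2_set_def sum_nonneg)

lemma reduced_density_entry:
  "reduced_density l \<Psi> $ a $ b =
     (\<Sum>i | i l = a. \<Psi> $ i * cnj (\<Psi> $ (i(l := b)))) / of_real ((norm \<Psi>)\<^sup>2)"
  by (simp add: reduced_density_def partial_trace_others_def pure_state_def sum_divide_distrib)

lemma reduced_density_diagonal:
  "reduced_density l \<Psi> $ a $ a =
     of_real ((\<Sum>i | i l = a. (cmod (\<Psi> $ i))\<^sup>2) / (norm \<Psi>)\<^sup>2)"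
proof -
  have "(\<Sum>i | i l = a. \<Psi> $ i * cnj (\<Psi> $ (i(l := a)))) =
      (\<Sum>i | i l = a. of_real ((cmod (\<Psi> $ i))\<^sup>2))"
    by (intro sum.cong) (auto simp: complex_norm_square fun_upd_idem simp flip: of_real_power)
  then show ?thesis by (simp add: reduced_density_entry)
qed

lemma reduced_density_hermitian:
  "reduced_density l \<Psi> $ 1 $ 0 = cnj (reduced_density l \<Psi> $ 0 $ 1)"
proof -
  have "(\<Sum>i | i l = 1. \<Psi> $ i * cnj (\<Psi> $ (i(l := 0)))) =
      (\<Sum>i | i l = 0. \<Psi> $ (i(l := 1)) * cnj (\<Psi> $ i))"
    by (rule sum.reindex_bij_witness[of _ "\<lambda>i. i(l := 1)" "\<lambda>i. i(l := 0)"])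
      (auto simp: fun_upd_idem)
  then show ?thesis
    by (simp add: reduced_density_entry mult.commute)
qed

lemma sum_split_config:
  fixes f :: "('n::finite \<Rightarrow> 2) \<Rightarrow> real"
  shows "sum f UNIV = (\<Sum>i | i l = 0. f i) + (\<Sum>i | i l = 1. f i)"
proof -
  have "UNIV = {i :: 'n \<Rightarrow> 2. i l = 0} \<union> {i. i l = 1}"
    using two_cases by auto
  then have "sum f UNIV = sum f ({i. i l = 0} \<union> {i. i l = 1})"
    by simp
  also have "\<dots> = (\<Sum>i | i l = 0. f i) + (\<Sum>i | i l = 1. f i)"
    by (rule sum.union_disjoint) auto
  finally show ?thesis .
qed

lemma sum_config_vertex:
  "(\<Sum>i\<in>UNIV. c i * config_vertex i $ l) = (\<Sum>i | i l = 1. c i) - sum c UNIV / 2"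
proof -
  have "(\<Sum>i | i l = 0. c i * config_vertex i $ l) = - (\<Sum>i | i l = 0. c i) / 2"
    by (simp add: config_vertex_def sum_divide_distrib flip: sum_negf)
  moreover have "(\<Sum>i | i l = 1. c i * config_vertex i $ l) = (\<Sum>i | i l = 1. c i) / 2"
    by (simp add: config_vertex_def sum_divide_distrib)
  ultimately show ?thesis
    unfolding sum_split_config[of _ l] by (simp add: field_simps)
qed

text \<open>The measurement probabilities act as barycentric weights, so prescribing
  \<open>mu_T\<close> becomes a question about convex combinations of vertices.\<close>

lemma mu_T_proj_eq:
  assumes "\<Psi> \<noteq> 0"
  shows "mu_T (proj \<Psi>) = (\<Sum>i\<in>UNIV. ((cmod (\<Psi> $ i))\<^sup>2 / (norm \<Psi>)\<^sup>2) *\<^sub>R config_vertex i)"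
proof -
  have "(\<Sum>i\<in>UNIV. (cmod (\<Psi> $ i))\<^sup>2 / (norm \<Psi>)\<^sup>2) = 1"
    using assms by (simp add: norm_squared_vec[symmetric] flip: sum_divide_distrib)
  then have "mu_T (proj \<Psi>) $ l =
      (\<Sum>i\<in>UNIV. (cmod (\<Psi> $ i))\<^sup>2 / (norm \<Psi>)\<^sup>2 * config_vertex i $ l)" for l
    using assms by (simp only: sum_config_vertex) (simp add: mu_T_proj reduced_density_diagonal sum_divide_distrib)
  then show ?thesis
    by (simp add: vec_eq_iff)
qed

text \<open>A reduced density matrix has trace one and is Hermitian, so the entries at
  \<open>(1,1)\<close> and \<open>(0,1)\<close> determine the other two.\<close>

lemma mu_proj_eq_iff:
  fixes \<beta> :: "real ^ 'n::finite"
  assumes "\<Psi> \<noteq> 0"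
  shows "mu (proj \<Psi>) = diagonal_element \<beta> \<longleftrightarrow>
    mu_T (proj \<Psi>) = \<beta> \<and> (\<forall>l. (\<Sum>i | i l = 0. \<Psi> $ i * cnj (\<Psi> $ (i(l := 1)))) = 0)"
proof -
  have N: "norm \<Psi> \<noteq> 0" using assms by simp
  have all2: "(\<forall>a::2. P a) \<longleftrightarrow> P 0 \<and> P 1" for P
    using two_cases by metis
  have "(reduced_density l \<Psi> - mat (1 / 2) = diag2 (- of_real (\<beta> $ l)) (of_real (\<beta> $ l))) \<longleftrightarrow>
      mu_T (proj \<Psi>) $ l = \<beta> $ l \<and> (\<Sum>i | i l = 0. \<Psi> $ i * cnj (\<Psi> $ (i(l := 1)))) = 0" for l
  proof -
    define x where "x a = (\<Sum>i | i l = a. (cmod (\<Psi> $ i))\<^sup>2) / (norm \<Psi>)\<^sup>2" for a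
    have "x 0 + x 1 = (\<Sum>i\<in>UNIV. (cmod (\<Psi> $ i))\<^sup>2) / (norm \<Psi>)\<^sup>2"
      unfolding x_def sum_split_config[of _ l] by (simp add: add_divide_distrib)
    then have x: "x 0 = 1 - x 1"
      using N by (simp flip: norm_squared_vec)
    have "mu_T (proj \<Psi>) $ l = x 1 - 1 / 2"
      using assms by (simp add: mu_T_proj reduced_density_diagonal x_def)
    moreover have "reduced_density l \<Psi> $ a $ a = of_real (x a)" for a
      by (simp add: reduced_density_diagonal x_def)
    moreover have "reduced_density l \<Psi> $ 0 $ 1 = 0 \<longleftrightarrow>
        (\<Sum>i | i l = 0. \<Psi> $ i * cnj (\<Psi> $ (i(l := 1)))) = 0"
      using N by (simp add: reduced_density_entry)
    moreover have "of_real (x 1) - 1 / 2 = complex_of_real (\<beta> $ l) \<longleftrightarrow> x 1 - 1 / 2 = \<beta> $ l"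
      by (simp add: complex_eq_iff)
    moreover have "1 - of_real (x 1) - 1 / 2 = - complex_of_real (\<beta> $ l) \<longleftrightarrow> x 1 - 1 / 2 = \<beta> $ l"
      by (auto simp: complex_eq_iff)
    ultimately show ?thesis
      by (auto simp add: vec_eq_iff all2 mat_def diag2_def reduced_density_hermitian x)
  qed
  then show ?thesis
    using assms by (auto simp: mu_proj diagonal_element_def vec_eq_iff[where 'b = 'n] vec_eq_iff[where 'a = real])
qed

section \<open>Fixed points of the one-parameter subgroup and their components\<close>

lemma projective_spaceE:
  assumes "x \<in> projective_space"
  obtains \<Psi> where "\<Psi> \<noteq> 0" "x = proj \<Psi>"
  using assms by (auto simp: projective_space_def)

lemma tensor_diag2_apply:
  "tensor_operator (\<lambda>l. diag2 (a l) (b l)) *v \<Psi> =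
     (\<chi> i. (\<Prod>l\<in>UNIV. if i l = 0 then a l else b l) * \<Psi> $ i)"
proof -
  have "(\<Prod>l\<in>UNIV. diag2 (a l) (b l) $ i l $ j l) =
      (if j = i then \<Prod>l\<in>UNIV. if i l = 0 then a l else b l else 0)" for i j :: "'a \<Rightarrow> 2"
  proof (cases "i = j")
    case False
    then obtain l where "i l \<noteq> j l" by auto
    then have "diag2 (a l) (b l) $ i l $ j l = 0" by (simp add: diag2_def)
    then have "(\<Prod>l\<in>UNIV. diag2 (a l) (b l) $ i l $ j l) = 0" by (meson UNIV_I finite prod_zero)
    with False show ?thesis by simp
  qed (auto simp: diag2_def intro!: prod.cong)
  then show ?thesis
    by (simp add: vec_eq_iff matrix_vector_mult_def tensor_operator_def if_distrib[of "\<lambda>c. c * _"] cong: if_cong)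
qed

text \<open>The single-qubit phases multiply, so every basis state is an eigenvector. The factor 2
  compensates for vertex coordinates being 1/2 in absolute value.\<close>

lemma T_subgroup_apply:
  "tensor_operator (\<lambda>l. diag2 (exp (- \<i> * of_real (\<beta> $ l * t))) (exp (\<i> * of_real (\<beta> $ l * t)))) *v \<Psi>
   = (\<chi> i. cis (2 * t * (config_vertex i \<bullet> \<beta>)) * \<Psi> $ i)"
proof -
  have "(\<Prod>l\<in>UNIV. if i l = 0 then exp (- \<i> * of_real (\<beta> $ l * t)) else exp (\<i> * of_real (\<beta> $ l * t)))
      = cis (2 * t * (config_vertex i \<bullet> \<beta>))" for i
  proof -
    have "(\<Prod>l\<in>UNIV. if i l = 0 then exp (- \<i> * of_real (\<beta> $ l * t)) else exp (\<i> * of_real (\<beta> $ l * t)))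
       = (\<Prod>l\<in>UNIV. exp (\<i> * of_real (2 * t * (config_vertex i $ l * \<beta> $ l))))"
    proof (rule prod.cong[OF refl])
      fix l
      show "(if i l = 0 then exp (- \<i> * of_real (\<beta> $ l * t)) else exp (\<i> * of_real (\<beta> $ l * t))) =
         exp (\<i> * of_real (2 * t * (config_vertex i $ l * \<beta> $ l)))"
        using two_cases[of "i l"] by (auto simp: config_vertex_def mult.commute)
    qed
    also have "\<dots> = cis (2 * t * (config_vertex i \<bullet> \<beta>))"
      by (simp add: cis_conv_exp inner_vec_def sum_distrib_left flip: exp_sum)
    finally show ?thesis .
  qed
  then show ?thesis
    by (simp only: tensor_diag2_apply)
qed

text \<open>A line is fixed exactly when it consists of common eigenvectors. Two basis states in the
  support then have equal phases at all times, which forces equal frequencies.\<close>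

lemma proj_in_T_fixed_points_iff:
  fixes \<beta> :: "real ^ 'n::finite"
  assumes "\<Psi> \<noteq> 0"
  shows "proj \<Psi> \<in> T_fixed_points \<beta> \<longleftrightarrow>
    (\<exists>c. \<forall>i. \<Psi> $ i \<noteq> 0 \<longrightarrow> config_vertex i \<bullet> \<beta> = c)"
proof
  define k where "k t = tensor_operator (\<lambda>l. diag2 (exp (- \<i> * of_real (\<beta> $ l * t)))
                                         (exp (\<i> * of_real (\<beta> $ l * t))))" for t
  have k: "k t *v \<Psi> = (\<chi> i. cis (2 * t * (config_vertex i \<bullet> \<beta>)) * \<Psi> $ i)" for t \<Psi>
    unfolding k_def by (rule T_subgroup_apply)
  have T: "T_subgroup \<beta> = range k"
    unfolding T_subgroup_def k_def ..
  {
    assume fixp: "proj \<Psi> \<in> T_fixed_points \<beta>"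
    have "\<exists>c. k t *v \<Psi> = c *s \<Psi>" for t
    proof -
      have "\<Psi> \<in> proj \<Psi>" by (simp add: proj_def vec.span_base)
      then have "k t *v \<Psi> \<in> proj \<Psi>"
        using fixp T unfolding T_fixed_points_def by blast
      then show ?thesis by (auto simp: proj_def vec.span_singleton)
    qed
    then obtain c where "\<And>t. k t *v \<Psi> = c t *s \<Psi>" by metis
    then have "cis (2 * t * (config_vertex i \<bullet> \<beta>)) * \<Psi> $ i = c t * \<Psi> $ i" for t i
      unfolding k vec_eq_iff by simp
    then have eq: "cis (2 * t * (config_vertex i \<bullet> \<beta>)) = cis (2 * t * (config_vertex j \<bullet> \<beta>))"
      if "\<Psi> $ i \<noteq> 0" "\<Psi> $ j \<noteq> 0" for t i j
      using that by (metis mult_cancel_right)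
    have "config_vertex i \<bullet> \<beta> = config_vertex j \<bullet> \<beta>" if ij: "\<Psi> $ i \<noteq> 0" "\<Psi> $ j \<noteq> 0" for i j
    proof (rule ccontr)
      assume ne: "config_vertex i \<bullet> \<beta> \<noteq> config_vertex j \<bullet> \<beta>"
      define d where "d = config_vertex i \<bullet> \<beta> - config_vertex j \<bullet> \<beta>"
      \<comment> \<open>At this time the two phases differ by the factor
        \<open>cis pi = -1\<close>.\<close>
      define t where "t = pi / (2 * d)"
      have "d \<noteq> 0" using ne by (simp add: d_def)
      have "cis (2 * t * d) = cis (2 * t * (config_vertex i \<bullet> \<beta>)) / cis (2 * t * (config_vertex j \<bullet> \<beta>))"
        by (simp add: d_def right_diff_distrib cis_divide)
      also have "\<dots> = 1" using eq[OF ij] by simp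
      finally show False using \<open>d \<noteq> 0\<close> by (simp add: t_def)
    qed
    then show "\<exists>c. \<forall>i. \<Psi> $ i \<noteq> 0 \<longrightarrow> config_vertex i \<bullet> \<beta> = c"
      by metis
  }
  {
    assume "\<exists>c. \<forall>i. \<Psi> $ i \<noteq> 0 \<longrightarrow> config_vertex i \<bullet> \<beta> = c"
    then obtain c where c: "\<And>i. \<Psi> $ i \<noteq> 0 \<Longrightarrow> config_vertex i \<bullet> \<beta> = c" by blast
    have "(*v) (k t) ` proj \<Psi> = proj \<Psi>" for t
    proof -
      have "cis (2 * t * (config_vertex i \<bullet> \<beta>)) * \<Psi> $ i = cis (2 * t * c) * \<Psi> $ i" for i
        using c[of i] by (cases "\<Psi> $ i = 0") auto
      then have scale: "k t *v (a *s \<Psi>) = (cis (2 * t * c) * a) *s \<Psi>" for a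
        by (simp add: k vec_eq_iff mult.left_commute)
      \<comment> \<open>Dividing by the nonzero phase gives a preimage, so the line is mapped onto
        itself and not merely into itself.\<close>
      have "a *s \<Psi> = k t *v ((a / cis (2 * t * c)) *s \<Psi>)" for a
        by (simp add: scale)
      then have "range (\<lambda>a. a *s \<Psi>) \<subseteq> (*v) (k t) ` range (\<lambda>a. a *s \<Psi>)"
        by blast
      then show ?thesis
        by (auto simp: proj_def vec.span_singleton scale)
    qed
    then show "proj \<Psi> \<in> T_fixed_points \<beta>"
      using assms by (auto simp: T_fixed_points_def projective_space_def T)
  }
qed

lemma mu_T_inner_of_support:
  fixes \<beta> :: "real ^ 'n::finite"
  assumes "\<Psi> \<noteq> 0" "\<And>i. \<Psi> $ i \<noteq> 0 \<Longrightarrow> config_vertex i \<bullet> \<beta> = c"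
  shows "mu_T (proj \<Psi>) \<bullet> \<beta> = c"
proof -
  have "mu_T (proj \<Psi>) \<bullet> \<beta> = (\<Sum>i\<in>UNIV. (cmod (\<Psi> $ i))\<^sup>2 / (norm \<Psi>)\<^sup>2 * (config_vertex i \<bullet> \<beta>))"
    using assms(1) by (simp add: mu_T_proj_eq inner_sum_left)
  also have "\<dots> = (\<Sum>i\<in>UNIV. (cmod (\<Psi> $ i))\<^sup>2 / (norm \<Psi>)\<^sup>2 * c)"
    using assms(2) by (intro sum.cong) auto
  also have "\<dots> = c"
    using assms(1) by (simp add: norm_squared_vec[symmetric] flip: sum_divide_distrib sum_distrib_right)
  finally show ?thesis .
qed

text \<open>By the quotient topology, continuity need only be checked on nonzero vectors, where the
  barycentre formula shows it.\<close>

lemma continuous_map_mu_T_inner: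
  fixes \<beta> :: "real ^ 'n::finite"
  shows "continuous_map projective_topology euclideanreal (\<lambda>x. mu_T x \<bullet> \<beta>)"
proof -
  have "continuous_on (- {0}) (\<lambda>\<Psi> :: 'n qubits. mu_T (proj \<Psi>) \<bullet> \<beta>)"
  proof (subst continuous_on_cong[OF refl])
    show "mu_T (proj \<Psi>) \<bullet> \<beta> =
        (\<Sum>i\<in>UNIV. ((cmod (\<Psi> $ i))\<^sup>2 / (norm \<Psi>)\<^sup>2) *\<^sub>R config_vertex i) \<bullet> \<beta>"
      if "\<Psi> \<in> - {0}" for \<Psi> :: "'n qubits"
      using that by (simp add: mu_T_proj_eq)
    show "continuous_on (- {0}) (\<lambda>\<Psi> :: 'n qubits.
        (\<Sum>i\<in>UNIV. ((cmod (\<Psi> $ i))\<^sup>2 / (norm \<Psi>)\<^sup>2) *\<^sub>R config_vertex i) \<bullet> \<beta>)"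
      by (intro continuous_intros) auto
  qed
  then have "continuous_map (top_of_set (- {0})) euclideanreal ((\<lambda>x. mu_T x \<bullet> \<beta>) \<circ> proj)"
    by (simp add: o_def)
  then show ?thesis
    using continuous_compose_quotient_map_eq[OF quotient_map_proj] by blast
qed

text \<open>On fixed points the function takes only the finitely many values
  \<open>config_vertex i \<bullet> \<beta>\<close>, and a continuous image of a connected set that
  is finite has at most one point. Hence the condition in \<open>Z_set\<close> can be tested at a
  single point of each component.\<close>

lemma mu_T_inner_constant_on_component:
  fixes \<beta> :: "real ^ 'n::finite"
  assumes C: "C \<in> connected_components_of (subtopology projective_topology (T_fixed_points \<beta>))"
    and "x \<in> C" "y \<in> C"
  shows "mu_T x \<bullet> \<beta> = mu_T y \<bullet> \<beta>"
proof -
  let ?f = "\<lambda>x. mu_T x \<bullet> \<beta>"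
  have "connectedin (subtopology projective_topology (T_fixed_points \<beta>)) C"
    using C by (rule connectedin_connected_components_of)
  then have "C \<subseteq> T_fixed_points \<beta>" "connectedin projective_topology C"
    by (simp_all add: connectedin_subtopology)
  then have "connected (?f ` C)"
    using connectedin_continuous_map_image[OF continuous_map_mu_T_inner] by simp
  moreover have "?f ` C \<subseteq> range (\<lambda>i. config_vertex i \<bullet> \<beta>)"
  proof
    fix z assume "z \<in> ?f ` C"
    then obtain w where w: "w \<in> T_fixed_points \<beta>" "z = ?f w"
      using \<open>C \<subseteq> T_fixed_points \<beta>\<close> by blast
    then obtain \<Psi> where \<Psi>: "\<Psi> \<noteq> 0" "w = proj \<Psi>"
      by (auto simp: T_fixed_points_def elim: projective_spaceE)
    then obtain c where c: "\<And>i. \<Psi> $ i \<noteq> 0 \<Longrightarrow> config_vertex i \<bullet> \<beta> = c"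
      using w by (auto simp: proj_in_T_fixed_points_iff)
    obtain i where "\<Psi> $ i \<noteq> 0" using \<Psi>(1) by (auto simp: vec_eq_iff)
    then have "z = config_vertex i \<bullet> \<beta>"
      using c mu_T_inner_of_support[OF \<Psi>(1) c] w(2) \<Psi>(2) by simp
    then show "z \<in> range (\<lambda>i. config_vertex i \<bullet> \<beta>)" by blast
  qed
  then have "finite (?f ` C)"
    by (rule finite_subset) simp
  ultimately have "?f ` C = {} \<or> (\<exists>a. ?f ` C = {a})"
    using connected_finite_iff_sing by blast
  then show ?thesis
    using assms(2,3) by (metis empty_iff imageI singletonD)
qed

text \<open>This reduces nonemptiness to finding amplitudes. Off-diagonal entries are a concern only
  at the zeros of \<open>\<beta>\<close>.\<close>

lemma proj_in_Z_set_mu_fibre: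
  fixes \<beta> :: "real ^ 'n::finite"
  assumes norm: "(\<Sum>i\<in>UNIV. (cmod (\<Psi> $ i))\<^sup>2) = 1"
    and mean: "\<And>l. (\<Sum>i\<in>UNIV. (cmod (\<Psi> $ i))\<^sup>2 * config_vertex i $ l) = \<beta> $ l"
    and supp: "\<And>i. \<Psi> $ i \<noteq> 0 \<Longrightarrow> config_vertex i \<bullet> \<beta> = \<beta> \<bullet> \<beta>"
    and off: "\<And>l. \<beta> $ l = 0 \<Longrightarrow> (\<Sum>i | i l = 0. \<Psi> $ i * cnj (\<Psi> $ (i(l := 1)))) = 0"
  shows "proj \<Psi> \<in> Z_set \<beta> \<inter> mu_fibre \<beta>"
proof -
  have "\<Psi> \<noteq> 0" using norm by auto
  have muT: "mu_T (proj \<Psi>) = \<beta>"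
    using \<open>\<Psi> \<noteq> 0\<close> norm mean by (simp add: mu_T_proj_eq vec_eq_iff norm_squared_vec)
  have "(\<Sum>i | i l = 0. \<Psi> $ i * cnj (\<Psi> $ (i(l := 1)))) = 0" for l
  proof (cases "\<beta> $ l = 0")
    case False
    have "\<Psi> $ i = 0 \<or> \<Psi> $ (i(l := 1)) = 0" if "i l = 0" for i
    proof (rule ccontr)
      assume "\<not> ?thesis"
      then have "(config_vertex (i(l := 1)) - config_vertex i) \<bullet> \<beta> = 0"
        using supp by (simp add: inner_diff_left)
      \<comment> \<open>Flipping qubit \<open>l\<close> changes the inner product with
        \<open>\<beta>\<close> by \<open>\<beta> $ l\<close>, so for nonzero
        \<open>\<beta> $ l\<close> both configurations cannot be in the support.\<close>
      moreover have "config_vertex (i(l := 1)) - config_vertex i = axis l 1"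
        using that by (auto simp: config_vertex_def vec_eq_iff axis_def)
      ultimately show False using False by (simp add: inner_axis')
    qed
    then show ?thesis by (intro sum.neutral) auto
  qed (rule off)
  then have fibre: "proj \<Psi> \<in> mu_fibre \<beta>"
    using \<open>\<Psi> \<noteq> 0\<close> muT by (simp add: mu_fibre_def mu_proj_eq_iff projective_space_def)
  let ?X = "subtopology projective_topology (T_fixed_points \<beta>)"
  have "proj \<Psi> \<in> T_fixed_points \<beta>"
    using \<open>\<Psi> \<noteq> 0\<close> supp by (auto simp: proj_in_T_fixed_points_iff)
  then have "proj \<Psi> \<in> topspace ?X"
    by (auto simp: topspace_projective_topology T_fixed_points_def)
  then obtain C where C: "C \<in> connected_components_of ?X" "proj \<Psi> \<in> C"
    using Union_connected_components_of[of ?X] by auto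
  then have "\<forall>x\<in>C. mu_T x \<bullet> \<beta> = \<beta> \<bullet> \<beta>"
    using mu_T_inner_constant_on_component[OF C(1) _ C(2)] muT by simp
  then show ?thesis
    using C fibre unfolding Z_set_def by blast
qed

section \<open>Convex weights at the closest point\<close>

text \<open>All of \<open>V\<close> lies in the half-space
  \<open>\<beta> \<bullet> \<beta> \<le> v \<bullet> \<beta>\<close>, and \<open>\<beta>\<close>, an
  average of \<open>V\<close>, lies on its boundary; so only vertices on the boundary carry
  weight.\<close>

lemma closest_point_weights:
  fixes \<beta> :: "real ^ 'n::finite"
  assumes "V \<noteq> {}" "V \<subseteq> hypercube_vertices" "\<beta> = closest_point (convex hull V) 0"
  obtains q :: "('n \<Rightarrow> 2) \<Rightarrow> real"
  where "\<And>i. 0 \<le> q i" "sum q UNIV = 1"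
    "\<And>i. q i \<noteq> 0 \<Longrightarrow> config_vertex i \<bullet> \<beta> = \<beta> \<bullet> \<beta>"
    "\<And>i l. q i \<noteq> 0 \<Longrightarrow> \<beta> $ l = 0 \<Longrightarrow> i l = 0"
    "\<And>l. \<beta> $ l \<noteq> 0 \<Longrightarrow> (\<Sum>i\<in>UNIV. q i * config_vertex i $ l) = \<beta> $ l"
proof -
  have vert: "v $ l = 1 / 2 \<or> v $ l = - 1 / 2" if "v \<in> V" for v l
    using assms(2) that by (auto simp: hypercube_vertices_eq)
  have "V \<subseteq> range config_vertex"
  proof
    fix v assume "v \<in> V"
    then have "v = config_vertex (\<lambda>l. if v $ l = 1 / 2 then 1 else 0)"
      using vert by (auto simp: config_vertex_def vec_eq_iff)
    then show "v \<in> range config_vertex" by blast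
  qed
  then have fin: "finite V" by (rule finite_subset) simp
  have closed: "closed (convex hull V)"
    using fin by (intro compact_imp_closed compact_convex_hull finite_imp_compact)
  then have "\<beta> \<in> convex hull V"
    using assms closest_point_in_set by (metis convex_hull_eq_empty)
  then obtain u where u: "\<And>v. v \<in> V \<Longrightarrow> 0 \<le> u v" "sum u V = 1" "(\<Sum>v\<in>V. u v *\<^sub>R v) = \<beta>"
    unfolding convex_hull_finite[OF fin] by blast
  have ge: "\<beta> \<bullet> \<beta> \<le> v \<bullet> \<beta>" if "v \<in> V" for v
  proof -
    \<comment> \<open>The obtuse angle criterion for the projection of \<open>0\<close> onto a
      closed convex set.\<close>
    have "(0 - \<beta>) \<bullet> (v - \<beta>) \<le> 0"
      unfolding assms(3) using closed that
      by (intro closest_point_dot) (auto intro: hull_inc)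
    then show ?thesis by (simp add: inner_diff_right inner_commute)
  qed
  have "(\<Sum>v\<in>V. u v * (v \<bullet> \<beta> - \<beta> \<bullet> \<beta>)) = (\<Sum>v\<in>V. u v *\<^sub>R v) \<bullet> \<beta> - sum u V * (\<beta> \<bullet> \<beta>)"
    by (simp add: right_diff_distrib sum_subtractf inner_sum_left sum_distrib_right)
  then have "(\<Sum>v\<in>V. u v * (v \<bullet> \<beta> - \<beta> \<bullet> \<beta>)) = 0"
    using u by simp
  then have tight: "v \<bullet> \<beta> = \<beta> \<bullet> \<beta>" if "v \<in> V" "u v \<noteq> 0" for v
    using that u(1) ge by (subst (asm) sum_nonneg_eq_0_iff[OF fin]) auto
  \<comment> \<open>Resetting the qubits at zeros of \<open>\<beta>\<close> to 0 leaves inner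
    products with \<open>\<beta>\<close> unchanged. The barycentre is kept only in the other
    coordinates.\<close>
  define conf :: "real ^ 'n \<Rightarrow> 'n \<Rightarrow> 2"
    where "conf v = (\<lambda>l. if \<beta> $ l = 0 \<or> v $ l = - 1 / 2 then 0 else 1)" for v
  have conf: "config_vertex (conf v) $ l = v $ l" if "v \<in> V" "\<beta> $ l \<noteq> 0" for v l
    using that vert[of v l] by (auto simp: config_vertex_def conf_def)
  have conf_inner: "config_vertex (conf v) \<bullet> \<beta> = v \<bullet> \<beta>" if "v \<in> V" for v
    unfolding inner_vec_def using conf[OF that] by (intro sum.cong) auto
  \<comment> \<open>Several vertices may have the same \<open>conf\<close>, so their weights are
    added.\<close>
  define q where "q i = (\<Sum>v | v \<in> V \<and> conf v = i. u v)" for i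
  have sum_q: "(\<Sum>i\<in>UNIV. q i * g i) = (\<Sum>v\<in>V. u v * g (conf v))" for g
  proof -
    have "(\<Sum>i\<in>UNIV. q i * g i) = (\<Sum>i\<in>UNIV. \<Sum>v | v \<in> V \<and> conf v = i. u v * g (conf v))"
      by (auto simp: q_def sum_distrib_right intro!: sum.cong)
    also have "\<dots> = (\<Sum>v\<in>V. u v * g (conf v))"
      using fin by (intro sum.group) auto
    finally show ?thesis .
  qed
  have q_pos: "\<exists>v\<in>V. u v \<noteq> 0 \<and> conf v = i" if "q i \<noteq> 0" for i
    using that sum.not_neutral_contains_not_neutral unfolding q_def by (metis (mono_tags, lifting) mem_Collect_eq)
  show thesis
  proof
    show "0 \<le> q i" for i
      unfolding q_def using u(1) by (intro sum_nonneg) auto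
    show "sum q UNIV = 1"
      using sum_q[of "\<lambda>_. 1"] u(2) by simp
    show "config_vertex i \<bullet> \<beta> = \<beta> \<bullet> \<beta>" if "q i \<noteq> 0" for i
      using q_pos[OF that] conf_inner tight by metis
    show "i l = 0" if "q i \<noteq> 0" "\<beta> $ l = 0" for i l
      using q_pos[OF that(1)] that(2) by (auto simp: conf_def)
    show "(\<Sum>i\<in>UNIV. q i * config_vertex i $ l) = \<beta> $ l" if "\<beta> $ l \<noteq> 0" for l
    proof -
      have "(\<Sum>i\<in>UNIV. q i * config_vertex i $ l) = (\<Sum>v\<in>V. u v * v $ l)"
        unfolding sum_q using conf[OF _ that] by (intro sum.cong) auto
      also have "\<dots> = (\<Sum>v\<in>V. u v *\<^sub>R v) $ l" by simp
      finally show ?thesis by (simp only: u(3))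
    qed
  qed
qed

text \<open>The deviation of \<open>x j\<close>, weighted by \<open>q j\<close>, has to be balanced
  by all the others. They contribute at most \<open>(1 - q j) * r\<close> in norm, whence
  \<open>q j \<le> 1 - q j\<close>.\<close>

lemma weight_le_half:
  fixes x :: "'a \<Rightarrow> 'b::real_inner" and q :: "'a \<Rightarrow> real"
  assumes "finite A" "\<And>i. i \<in> A \<Longrightarrow> 0 \<le> q i" "sum q A = 1"
    and mean: "(\<Sum>i\<in>A. q i *\<^sub>R x i) = b"
    and dist: "\<And>i. i \<in> A \<Longrightarrow> q i \<noteq> 0 \<Longrightarrow> norm (x i - b) = r"
    and "0 < r" "j \<in> A"
  shows "2 * q j \<le> 1"
proof (cases "q j = 0")
  case False
  have "(\<Sum>i\<in>A. q i *\<^sub>R (x i - b)) = 0"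
    using assms by (simp add: scaleR_diff_right sum_subtractf flip: scaleR_left.sum)
  then have "q j *\<^sub>R (x j - b) = - (\<Sum>i\<in>A - {j}. q i *\<^sub>R (x i - b))"
    using assms by (simp add: sum.remove[of A j] eq_neg_iff_add_eq_0)
  then have "norm (q j *\<^sub>R (x j - b)) = norm (\<Sum>i\<in>A - {j}. q i *\<^sub>R (x i - b))"
    by (simp only: norm_minus_cancel)
  then have "q j * r = norm (\<Sum>i\<in>A - {j}. q i *\<^sub>R (x i - b))"
    using dist[OF \<open>j \<in> A\<close> False] assms(2)[OF \<open>j \<in> A\<close>] by simp
  also have "\<dots> \<le> (\<Sum>i\<in>A - {j}. q i * r)"
  proof (rule sum_norm_le)
    show "norm (q i *\<^sub>R (x i - b)) \<le> q i * r" if "i \<in> A - {j}" for i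
      using that assms(2)[of i] dist[of i] by (cases "q i = 0") auto
  qed
  also have "\<dots> = (1 - q j) * r"
    using assms by (simp add: sum_diff1 flip: sum_distrib_right)
  finally show ?thesis using \<open>0 < r\<close> by simp
qed simp

section \<open>Construction of a state in the fibre\<close>

lemma Z_set_mu_fibre_nonempty:
  fixes \<beta> :: "real ^ 'n::finite"
  assumes nonneg: "\<And>l. 0 \<le> \<beta> $ l"
    and V: "V \<noteq> {}" "V \<subseteq> hypercube_vertices" "\<beta> = closest_point (convex hull V) 0"
    and not_exceptional: "\<nexists>m. \<beta> $ m = 0 \<and> (\<forall>l. l \<noteq> m \<longrightarrow> \<beta> $ l = 1 / 2)"
  shows "Z_set \<beta> \<inter> mu_fibre \<beta> \<noteq> {}"
proof -
  obtain q :: "('n \<Rightarrow> 2) \<Rightarrow> real"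
    where q_nonneg: "\<And>i. 0 \<le> q i" and q_sum: "sum q UNIV = 1"
      and q_inner: "\<And>i. q i \<noteq> 0 \<Longrightarrow> config_vertex i \<bullet> \<beta> = \<beta> \<bullet> \<beta>"
      and q_zero: "\<And>i l. q i \<noteq> 0 \<Longrightarrow> \<beta> $ l = 0 \<Longrightarrow> i l = 0"
      and q_mean: "\<And>l. \<beta> $ l \<noteq> 0 \<Longrightarrow> (\<Sum>i\<in>UNIV. q i * config_vertex i $ l) = \<beta> $ l"
    using closest_point_weights[OF V] by blast
  show ?thesis
  proof (cases "\<exists>l. \<beta> $ l = 0")
    case False
    define \<Psi> :: "'n qubits" where "\<Psi> = (\<chi> i. of_real (sqrt (q i)))"
    have "(cmod (\<Psi> $ i))\<^sup>2 = q i" for i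
      using q_nonneg by (simp add: \<Psi>_def)
    moreover have "q i \<noteq> 0" if "\<Psi> $ i \<noteq> 0" for i
      using that by (auto simp: \<Psi>_def)
    ultimately have "proj \<Psi> \<in> Z_set \<beta> \<inter> mu_fibre \<beta>"
      using False q_sum q_inner q_mean by (intro proj_in_Z_set_mu_fibre) auto
    then show ?thesis by blast
  next
    case True
    \<comment> \<open>\<open>up\<close> and \<open>down\<close> are mutually inverse bijections
      between \<open>A\<close> and \<open>B\<close>; they supply the two branches of the
      superposition.\<close>
    define A where "A = {i :: 'n \<Rightarrow> 2. \<forall>l. \<beta> $ l = 0 \<longrightarrow> i l = 0}"
    define B where "B = {i :: 'n \<Rightarrow> 2. \<forall>l. \<beta> $ l = 0 \<longrightarrow> i l = 1}"
    define up :: "('n \<Rightarrow> 2) \<Rightarrow> 'n \<Rightarrow> 2" where "up i = (\<lambda>l. if \<beta> $ l = 0 then 1 else i l)" for i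
    define down :: "('n \<Rightarrow> 2) \<Rightarrow> 'n \<Rightarrow> 2" where "down i = (\<lambda>l. if \<beta> $ l = 0 then 0 else i l)" for i
    have disj: "A \<inter> B = {}" using True by (auto simp: A_def B_def)
    have q_outside: "q i = 0" if "i \<notin> A" for i
      using that q_zero by (auto simp: A_def)
    have q_sum_A: "(\<Sum>i\<in>A. q i * g i) = (\<Sum>i\<in>UNIV. q i * g i)" for g
      using q_outside by (intro sum.mono_neutral_left) auto
    \<comment> \<open>Cancelling phases are demanded only when \<open>\<beta>\<close> has exactly
      one zero; otherwise any \<open>\<theta>\<close> will do.\<close>
    have "\<exists>\<theta>. \<forall>m. (\<forall>l. \<beta> $ l = 0 \<longleftrightarrow> l = m) \<longrightarrow> (\<Sum>i\<in>UNIV. of_real (q i) * cis (\<theta> i)) = 0"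
    proof (cases "\<exists>m. \<forall>l. \<beta> $ l = 0 \<longleftrightarrow> l = m")
      case True
      then obtain m where m: "\<And>l. \<beta> $ l = 0 \<longleftrightarrow> l = m" by blast
      \<comment> \<open>Dropping coordinate \<open>m\<close> makes the barycentre equal to
        \<open>\<beta>\<close>. The points \<open>x i\<close> have equal norms and, where
        \<open>q i\<close> is nonzero, equal inner products with \<open>\<beta>\<close>, hence equal
        distances from it.\<close>
      define x :: "('n \<Rightarrow> 2) \<Rightarrow> real ^ 'n"
        where "x i = (\<chi> l. if \<beta> $ l = 0 then 0 else config_vertex i $ l)" for i
      have x_inner: "x i \<bullet> \<beta> = config_vertex i \<bullet> \<beta>" for i
        unfolding inner_vec_def by (intro sum.cong) (auto simp: x_def)
      have x_norm: "x i \<bullet> x i = (\<Sum>l\<in>UNIV. if \<beta> $ l = 0 then 0 else 1 / 4)" for i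
        unfolding inner_vec_def by (intro sum.cong) (auto simp: x_def config_vertex_def)
      define r where "r = sqrt ((\<Sum>l\<in>UNIV. if \<beta> $ l = 0 then 0 else 1 / 4) - \<beta> \<bullet> \<beta>)"
      have dist: "norm (x i - \<beta>) = r" if "q i \<noteq> 0" for i
      proof -
        have "(x i - \<beta>) \<bullet> (x i - \<beta>) = x i \<bullet> x i - 2 * (x i \<bullet> \<beta>) + \<beta> \<bullet> \<beta>"
          by (simp add: inner_diff_left inner_diff_right inner_commute)
        then show ?thesis
          unfolding norm_eq_sqrt_inner r_def x_norm x_inner q_inner[OF that] by simp
      qed
      have mean: "(\<Sum>i\<in>UNIV. q i *\<^sub>R x i) = \<beta>"
      proof -
        have "(\<Sum>i\<in>UNIV. q i * x i $ l) = \<beta> $ l" for l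
          using q_mean[of l] by (cases "\<beta> $ l = 0") (simp_all add: x_def)
        then show ?thesis by (simp add: vec_eq_iff)
      qed
      obtain k where k: "q k \<noteq> 0"
        using q_sum by (metis sum.neutral zero_neq_one)
      \<comment> \<open>At distance zero, \<open>\<beta>\<close> would agree with a vertex away from
        \<open>m\<close>; nonnegativity makes those entries \<open>1 / 2\<close>, the excluded
        vector.\<close>
      have "r \<noteq> 0"
      proof
        assume "r = 0"
        then have "x k = \<beta>" using dist[OF k] by simp
        then have "\<beta> $ l = 1 / 2" if "l \<noteq> m" for l
          using that m nonneg[of l]
          by (auto simp: x_def config_vertex_def vec_eq_iff split: if_splits dest!: spec[of _ l])
        then show False using not_exceptional m by blast
      qed
      then have "0 < r" using dist[OF k] by (metis norm_ge_zero order_le_less)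
      then have "2 * q i \<le> 1" for i
        using weight_le_half[of UNIV q x \<beta> r i] q_nonneg q_sum mean dist by simp
      then obtain \<theta> where "(\<Sum>i\<in>UNIV. of_real (q i) * cis (\<theta> i)) = 0"
        using polygon_closes[of UNIV q] q_nonneg q_sum by auto
      then show ?thesis by blast
    qed auto
    then obtain \<theta> where \<theta>: "\<And>m. (\<And>l. \<beta> $ l = 0 \<longleftrightarrow> l = m) \<Longrightarrow>
        (\<Sum>i\<in>UNIV. of_real (q i) * cis (\<theta> i)) = 0"
      by blast
    \<comment> \<open>Each weight \<open>q i\<close> is split evenly between \<open>i\<close> and
      \<open>up i\<close>, so the mean at a zero of \<open>\<beta>\<close> is 0. The phase on the
      \<open>A\<close> branch alone is the relative phase.\<close>
    define \<Psi> :: "'n qubits" where "\<Psi> = (\<chi> i.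
        if i \<in> A then of_real (sqrt (q i / 2)) * cis (\<theta> i)
        else if i \<in> B then of_real (sqrt (q (down i) / 2)) else 0)"
    have sq_A: "(cmod (\<Psi> $ i))\<^sup>2 = q i / 2" if "i \<in> A" for i
      using that q_nonneg[of i] by (simp add: \<Psi>_def norm_mult)
    have sq_B: "(cmod (\<Psi> $ i))\<^sup>2 = q (down i) / 2" if "i \<in> B" for i
      using that disj q_nonneg[of "down i"] by (auto simp: \<Psi>_def)
    have zero: "\<Psi> $ i = 0" if "i \<notin> A" "i \<notin> B" for i
      using that by (simp add: \<Psi>_def)
    \<comment> \<open>With \<open>g\<close> constant this gives the norm of the state, and with
      \<open>g\<close> a vertex coordinate its mean.\<close>
    have sum_eq: "(\<Sum>i\<in>UNIV. (cmod (\<Psi> $ i))\<^sup>2 * g i) = (\<Sum>i\<in>UNIV. q i * ((g i + g (up i)) / 2))" for g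
    proof -
      have "(\<Sum>i\<in>UNIV. (cmod (\<Psi> $ i))\<^sup>2 * g i) = (\<Sum>i\<in>A \<union> B. (cmod (\<Psi> $ i))\<^sup>2 * g i)"
        using zero by (intro sum.mono_neutral_right) auto
      also have "\<dots> = (\<Sum>i\<in>A. (cmod (\<Psi> $ i))\<^sup>2 * g i) + (\<Sum>i\<in>B. (cmod (\<Psi> $ i))\<^sup>2 * g i)"
        using disj by (intro sum.union_disjoint) auto
      also have "(\<Sum>i\<in>A. (cmod (\<Psi> $ i))\<^sup>2 * g i) = (\<Sum>i\<in>A. q i * (g i / 2))"
        using sq_A by (intro sum.cong) auto
      also have "(\<Sum>i\<in>B. (cmod (\<Psi> $ i))\<^sup>2 * g i) = (\<Sum>i\<in>B. q (down i) * (g i / 2))"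
        using sq_B by (intro sum.cong) auto
      also have "\<dots> = (\<Sum>i\<in>A. q i * (g (up i) / 2))"
        by (rule sum.reindex_bij_witness[of _ up down])
          (auto simp: A_def B_def up_def down_def fun_eq_iff intro!: arg_cong[of _ _ g])
      finally show ?thesis
        unfolding q_sum_A by (simp add: add_divide_distrib distrib_left sum.distrib)
    qed
    have up_vertex: "config_vertex (up i) $ l = config_vertex i $ l" if "\<beta> $ l \<noteq> 0" for i l
      using that by (simp add: config_vertex_def up_def)
    have vertex_down: "config_vertex (down i) $ l = config_vertex i $ l" if "\<beta> $ l \<noteq> 0" for i l
      using that by (simp add: config_vertex_def down_def)
    have "proj \<Psi> \<in> Z_set \<beta> \<inter> mu_fibre \<beta>"
    proof (rule proj_in_Z_set_mu_fibre)
      show "(\<Sum>i\<in>UNIV. (cmod (\<Psi> $ i))\<^sup>2) = 1"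
        using sum_eq[of "\<lambda>_. 1"] q_sum by simp
      show "(\<Sum>i\<in>UNIV. (cmod (\<Psi> $ i))\<^sup>2 * config_vertex i $ l) = \<beta> $ l" for l
      proof (cases "\<beta> $ l = 0")
        case True
        have "q i * ((config_vertex i $ l + config_vertex (up i) $ l) / 2) = 0" for i
          using True q_zero[of i l] by (cases "q i = 0") (auto simp: config_vertex_def up_def)
        then show ?thesis by (simp only: sum_eq True sum.neutral_const)
      next
        case False
        then show ?thesis using q_mean by (simp add: sum_eq up_vertex)
      qed
      show "config_vertex i \<bullet> \<beta> = \<beta> \<bullet> \<beta>" if nz: "\<Psi> $ i \<noteq> 0" for i
      proof (cases "i \<in> A")
        case True
        then show ?thesis using nz q_inner[of i] by (auto simp: \<Psi>_def)
      next
        case False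
        then have "q (down i) \<noteq> 0" using nz by (auto simp: \<Psi>_def split: if_splits)
        moreover have "config_vertex (down i) \<bullet> \<beta> = config_vertex i \<bullet> \<beta>"
          unfolding inner_vec_def using vertex_down by (intro sum.cong) auto
        ultimately show ?thesis using q_inner by metis
      qed
      show "(\<Sum>i | i m = 0. \<Psi> $ i * cnj (\<Psi> $ (i(m := 1)))) = 0" if m: "\<beta> $ m = 0" for m
      proof (cases "\<forall>l. \<beta> $ l = 0 \<longrightarrow> l = m")
        case True
        then have Z: "\<beta> $ l = 0 \<longleftrightarrow> l = m" for l using m by blast
        have "{i. i m = 0} = A" by (auto simp: A_def Z)
        then have "(\<Sum>i | i m = 0. \<Psi> $ i * cnj (\<Psi> $ (i(m := 1)))) =
            (\<Sum>i\<in>A. \<Psi> $ i * cnj (\<Psi> $ (i(m := 1))))" by simp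
        also have "\<dots> = (\<Sum>i\<in>A. of_real (q i) * cis (\<theta> i) / 2)"
        proof (rule sum.cong[OF refl])
          \<comment> \<open>Flipping the only zero qubit turns \<open>i\<close> into its partner in
            \<open>B\<close>, so the two branches interfere.\<close>
          show "\<Psi> $ i * cnj (\<Psi> $ (i(m := 1))) = of_real (q i) * cis (\<theta> i) / 2" if "i \<in> A" for i
          proof -
            have "i(m := 1) \<in> B" "i(m := 1) \<notin> A" by (auto simp: A_def B_def Z)
            moreover have "down (i(m := 1)) = i" using that by (auto simp: down_def A_def Z)
            ultimately have "\<Psi> $ (i(m := 1)) = of_real (sqrt (q i / 2))"
              by (simp add: \<Psi>_def)
            moreover have "\<Psi> $ i = of_real (sqrt (q i / 2)) * cis (\<theta> i)"
              using that by (simp add: \<Psi>_def)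
            ultimately have "\<Psi> $ i * cnj (\<Psi> $ (i(m := 1))) =
                of_real (sqrt (q i / 2) * sqrt (q i / 2)) * cis (\<theta> i)"
              by (simp only: of_real_mult complex_cnj_complex_of_real mult_ac)
            moreover have "sqrt (q i / 2) * sqrt (q i / 2) = q i / 2"
              using q_nonneg[of i] by (intro real_sqrt_mult_self[THEN trans]) simp
            ultimately show ?thesis by simp
          qed
        qed
        also have "\<dots> = (\<Sum>i\<in>A. of_real (q i) * cis (\<theta> i)) / 2"
          by (rule sum_divide_distrib[symmetric])
        also have "(\<Sum>i\<in>A. of_real (q i) * cis (\<theta> i)) = (\<Sum>i\<in>UNIV. of_real (q i) * cis (\<theta> i))"
          using q_outside by (intro sum.mono_neutral_left) auto
        finally show ?thesis by (simp only: \<theta>[OF Z] div_0)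
      next
        case False
        then obtain l where l: "\<beta> $ l = 0" "l \<noteq> m" by blast
        \<comment> \<open>The support needs \<open>l\<close> and \<open>m\<close> to agree, and
          flipping \<open>m\<close> alone breaks this.\<close>
        have "\<Psi> $ i = 0 \<or> \<Psi> $ (i(m := 1)) = 0" if "i m = 0" for i
        proof (rule ccontr)
          assume "\<not> ?thesis"
          then have "i \<in> A \<union> B" "i(m := 1) \<in> A \<union> B" using zero by auto
          then have "i \<in> A" "i(m := 1) \<in> B" using that m by (auto simp: A_def B_def)
          then show False using l by (auto simp: A_def B_def)
        qed
        then show ?thesis by (intro sum.neutral) auto
      qed
    qed
    then show ?thesis by blast
  qed
qed

section \<open>The exceptional vector\<close>

text \<open>All qubits other than \<open>m\<close> are in state 1 with certainty, which leaves two
  amplitudes. Vanishing \<open>\<beta> $ m\<close> makes both nonzero, whereas a vanishing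
  off-diagonal entry makes their product zero.\<close>

lemma mu_fibre_empty:
  fixes \<beta> :: "real ^ 'n::finite"
  assumes m: "\<beta> $ m = 0" and other: "\<And>l. l \<noteq> m \<Longrightarrow> \<beta> $ l = 1 / 2"
  shows "mu_fibre \<beta> = {}"
proof (rule ccontr)
  assume "mu_fibre \<beta> \<noteq> {}"
  then obtain x where x: "x \<in> projective_space" "mu x = diagonal_element \<beta>"
    by (auto simp: mu_fibre_def)
  then obtain \<Psi> where \<Psi>: "\<Psi> \<noteq> 0" "x = proj \<Psi>"
    by (auto elim: projective_spaceE)
  define N where "N = (norm \<Psi>)\<^sup>2"
  have N: "0 < N" using \<Psi>(1) by (simp add: N_def)
  have muT: "mu_T (proj \<Psi>) = \<beta>"
    and off: "(\<Sum>i | i m = 0. \<Psi> $ i * cnj (\<Psi> $ (i(m := 1)))) = 0"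
    using x(2) mu_proj_eq_iff[OF \<Psi>(1)] \<Psi>(2) by auto
  have ones: "(\<Sum>i | i l = 1. (cmod (\<Psi> $ i))\<^sup>2) = (1 / 2 + \<beta> $ l) * N" for l
    using N \<Psi>(1) muT by (auto simp: mu_T_proj reduced_density_diagonal vec_eq_iff field_simps simp flip: N_def)
  have zeros: "(\<Sum>i | i l = 0. (cmod (\<Psi> $ i))\<^sup>2) = (1 / 2 - \<beta> $ l) * N" for l
    using sum_split_config[of "\<lambda>i. (cmod (\<Psi> $ i))\<^sup>2" l] ones[of l] norm_squared_vec[of \<Psi>]
    by (simp add: N_def algebra_simps)
  define a :: "'n \<Rightarrow> 2" where "a = (\<lambda>l. 1)"
  have null: "\<Psi> $ i = 0" if "i l = 0" "l \<noteq> m" for i l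
  proof -
    have "(\<Sum>i | i l = 0. (cmod (\<Psi> $ i))\<^sup>2) = 0"
      using zeros[of l] other[OF that(2)] by simp
    then show ?thesis using that(1) by (subst (asm) sum_nonneg_eq_0_iff) auto
  qed
  have supp: "i = a(m := i m)" if "\<Psi> $ i \<noteq> 0" for i
    using null[of i] that two_cases by (fastforce simp: a_def)
  \<comment> \<open>Only \<open>a(m := 0)\<close> and \<open>a(m := 1)\<close> can be in the
    support, so fixing qubit \<open>m\<close> leaves one term.\<close>
  have single: "(\<Sum>i | i m = b. f i) = f (a(m := b))"
    if f: "\<And>i. \<Psi> $ i = 0 \<Longrightarrow> f i = 0" for b and f :: "('n \<Rightarrow> 2) \<Rightarrow> 'c::comm_monoid_add"
  proof -
    have "(\<Sum>i | i m = b. f i) = (\<Sum>i\<in>{a(m := b)}. f i)"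
      using supp f by (intro sum.mono_neutral_right) fastforce+
    then show ?thesis by simp
  qed
  have "\<Psi> $ (a(m := 0)) \<noteq> 0" "\<Psi> $ (a(m := 1)) \<noteq> 0"
    using single[of "\<lambda>i. (cmod (\<Psi> $ i))\<^sup>2"] ones[of m] zeros[of m] m N by auto
  moreover have "\<Psi> $ (a(m := 0)) * cnj (\<Psi> $ (a(m := 1))) = 0"
    using single[of "\<lambda>i. \<Psi> $ i * cnj (\<Psi> $ (i(m := 1)))" 0] off by simp
  ultimately show False by simp
qed

section \<open>Equality up to permutation, and the criterion\<close>

text \<open>Equal multisets of components express equality up to permutation. Removing an index
  where \<open>f\<close> takes the value \<open>b\<close> leaves copies of \<open>c\<close>
  only.\<close>

lemma image_mset_eq_exceptional_iff:
  fixes f :: "'n::finite \<Rightarrow> 'a"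
  assumes "b \<noteq> c"
  shows "image_mset f (mset_set UNIV) = replicate_mset (CARD('n) - 1) c + {#b#} \<longleftrightarrow>
    (\<exists>m. f m = b \<and> (\<forall>l. l \<noteq> m \<longrightarrow> f l = c))"
proof -
  have split: "image_mset f (mset_set UNIV) = image_mset f (mset_set (UNIV - {m})) + {#f m#}" for m
    using mset_set.remove[of UNIV m] by simp
  have card: "CARD('n) - 1 = card (UNIV - {m} :: 'n set)" for m
    by (simp add: card_Diff_singleton)
  show ?thesis
  proof
    assume eq: "image_mset f (mset_set UNIV) = replicate_mset (CARD('n) - 1) c + {#b#}"
    then have "b \<in># image_mset f (mset_set UNIV)" by simp
    then obtain m where m: "f m = b" by auto
    then have "image_mset f (mset_set (UNIV - {m})) = replicate_mset (CARD('n) - 1) c"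
      using eq split[of m] by simp
    then have "f ` (UNIV - {m}) \<subseteq> {c}"
      by (metis finite_set_mset_mset_set finite set_image_mset set_mset_replicate_mset_subset subset_singleton_iff order_refl)
    with m show "\<exists>m. f m = b \<and> (\<forall>l. l \<noteq> m \<longrightarrow> f l = c)" by auto
  next
    assume "\<exists>m. f m = b \<and> (\<forall>l. l \<noteq> m \<longrightarrow> f l = c)"
    then obtain m where m: "f m = b" "\<And>l. l \<noteq> m \<Longrightarrow> f l = c" by blast
    have "image_mset f (mset_set (UNIV - {m})) = image_mset (\<lambda>_. c) (mset_set (UNIV - {m}))"
      using m by (intro image_mset_cong) auto
    then show "image_mset f (mset_set UNIV) = replicate_mset (CARD('n) - 1) c + {#b#}"
      using split[of m] m(1) card[of m] by (simp add: image_mset_const_eq)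
  qed
qed

theorem theorem10:
  fixes \<beta> :: "real ^ 'n::finite"
  assumes "\<And>l. 0 \<le> \<beta> $ l"
    and "\<exists>V. V \<noteq> {} \<and> V \<subseteq> hypercube_vertices \<and> \<beta> = closest_point (convex hull V) 0"
  shows "Z_set \<beta> \<inter> mu_fibre \<beta> \<noteq> {} \<longleftrightarrow>
    image_mset (\<lambda>l. \<beta> $ l) (mset_set UNIV) \<noteq> replicate_mset (CARD('n) - 1) (1 / 2) + {#0#}"
proof -
  have "image_mset (\<lambda>l. \<beta> $ l) (mset_set UNIV) = replicate_mset (CARD('n) - 1) (1 / 2) + {#0#} \<longleftrightarrow>
      (\<exists>m. \<beta> $ m = 0 \<and> (\<forall>l. l \<noteq> m \<longrightarrow> \<beta> $ l = 1 / 2))"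
    by (rule image_mset_eq_exceptional_iff) simp
  moreover obtain V where V: "V \<noteq> {}" "V \<subseteq> hypercube_vertices" "\<beta> = closest_point (convex hull V) 0"
    using assms(2) by auto
  have "Z_set \<beta> \<inter> mu_fibre \<beta> \<noteq> {} \<longleftrightarrow>
      \<not> (\<exists>m. \<beta> $ m = 0 \<and> (\<forall>l. l \<noteq> m \<longrightarrow> \<beta> $ l = 1 / 2))"
  proof
    show "\<not> (\<exists>m. \<beta> $ m = 0 \<and> (\<forall>l. l \<noteq> m \<longrightarrow> \<beta> $ l = 1 / 2))" if "Z_set \<beta> \<inter> mu_fibre \<beta> \<noteq> {}"
      using that mu_fibre_empty[of \<beta>] by auto
  qed (rule Z_set_mu_fibre_nonempty[OF assms(1) V])
  ultimately show ?thesis by simp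
qed

end
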